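(* For every prime $p$, the chromatic number of the 334-triangle graph of $SL_3(\mathbb{Z})$ is at most the chromatic number of the 334-triangle graph of $SL_3(\mathbb{Z}/p\mathbb{Z})$: $$\chi(\Delta 334(SL_3(\mathbb{Z}))) \le \chi(\Delta 334(SL_3(\mathbb{Z}/p\mathbb{Z}))).$$ Here both chromatic numbers are those of the graphs with the identity vertex (which carries a loop and is adjacent to no other vertex) deleted.
   Context: For a group $G$ with identity $e$, the 334-triangle graph $\Delta 334(G)$ is the undirected graph whose vertices are the elements $a\in G$ with $a^3=e$, with an edge between vertices $a$ and $b$ if and only if $(ab)^4=e$. In this graph the identity is adjacent to itself and to no other vertex, and it is the only vertex with a loop. $SL_3(R)$ denotes the group of $3\times 3$ matrices with entries in $R$ and determinant $1$. $\chi$ denotes the chromatic number (minimum number of colors in a coloring where adjacent vertices receive different colors). *)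

theory Defs
  imports
    "HOL-Analysis.Determinants"
    "HOL-Library.Extended_Nat"
    "HOL-Algebra.Group"
    "Berlekamp_Zassenhaus.Finite_Field"
begin

definition special_linear :: "('a::comm_ring_1 ^ 'n ^ 'n) monoid" where
  "special_linear = \<lparr>carrier = {A. det A = 1}, mult = (**), one = mat 1\<rparr>"

abbreviation SL3 :: "('a::comm_ring_1 ^ 3 ^ 3) monoid" where
  "SL3 \<equiv> special_linear"

text \<open>
  An undirected graph is a vertex set with a set of unordered edges; loops are allowed, the loop
  at \<open>v\<close> being the singleton edge \<open>{v, v} = {v}\<close>.
\<close>

record 'a ugraph =
  verts :: "'a set"
  edges :: "'a set set"

definition delete_vertex :: "'a ugraph \<Rightarrow> 'a \<Rightarrow> 'a ugraph" where
  "delete_vertex \<Gamma> v =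
     \<lparr>verts = verts \<Gamma> - {v}, edges = {e \<in> edges \<Gamma>. v \<notin> e}\<rparr>"

definition colorable :: "'a ugraph \<Rightarrow> nat \<Rightarrow> bool" where
  "colorable \<Gamma> k \<longleftrightarrow>
     (\<exists>c::'a \<Rightarrow> nat. c ` verts \<Gamma> \<subseteq> {..<k} \<and> (\<forall>u v. {u, v} \<in> edges \<Gamma> \<longrightarrow> c u \<noteq> c v))"

text \<open>The value is \<open>\<infinity>\<close> exactly if no finite number of colors suffices.\<close>

definition chromatic_number :: "'a ugraph \<Rightarrow> enat" where
  "chromatic_number \<Gamma> = Inf {enat k |k. colorable \<Gamma> k}"

definition triangle_graph_334 :: "('a, 'b) monoid_scheme \<Rightarrow> 'a ugraph" where
  "triangle_graph_334 G =
     \<lparr>verts = {a \<in> carrier G. a [^]\<^bsub>G\<^esub> (3::nat) = \<one>\<^bsub>G\<^esub>},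
      edges = {{a, b} |a b. a \<in> carrier G \<and> b \<in> carrier G \<and>
        a [^]\<^bsub>G\<^esub> (3::nat) = \<one>\<^bsub>G\<^esub> \<and> b [^]\<^bsub>G\<^esub> (3::nat) = \<one>\<^bsub>G\<^esub> \<and>
        (a \<otimes>\<^bsub>G\<^esub> b) [^]\<^bsub>G\<^esub> (4::nat) = \<one>\<^bsub>G\<^esub>}\<rparr>"

text \<open>
  The relation \<open>(a \<otimes> b) [^] 4 = \<one>\<close> is symmetric in a group, so unordered edges lose nothing.
\<close>

lemma triangle_relation_sym:
  assumes "group G" "a \<in> carrier G" "b \<in> carrier G"
    and ab: "(a \<otimes>\<^bsub>G\<^esub> b) [^]\<^bsub>G\<^esub> (4::nat) = \<one>\<^bsub>G\<^esub>"
  shows "(b \<otimes>\<^bsub>G\<^esub> a) [^]\<^bsub>G\<^esub> (4::nat) = \<one>\<^bsub>G\<^esub>"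
proof -
  interpret group G by fact
  have "a \<otimes>\<^bsub>G\<^esub> (b \<otimes>\<^bsub>G\<^esub> a) [^]\<^bsub>G\<^esub> (n::nat) = (a \<otimes>\<^bsub>G\<^esub> b) [^]\<^bsub>G\<^esub> n \<otimes>\<^bsub>G\<^esub> a" for n
    by (induction n) (use assms(2,3) in \<open>simp_all flip: m_assoc\<close>)
  from this[of 4] show ?thesis
    using assms by (simp add: l_cancel_one)
qed

lemma edge_triangle_graph_334_iff:
  assumes "group G"
  shows "{a, b} \<in> edges (triangle_graph_334 G) \<longleftrightarrow>
    a \<in> verts (triangle_graph_334 G) \<and> b \<in> verts (triangle_graph_334 G) \<and>
    (a \<otimes>\<^bsub>G\<^esub> b) [^]\<^bsub>G\<^esub> (4::nat) = \<one>\<^bsub>G\<^esub>"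
  using triangle_relation_sym[OF assms]
  by (auto simp: triangle_graph_334_def doubleton_eq_iff)

lemma group_SL3: "group (SL3 :: ('a::comm_ring_1 ^ 3 ^ 3) monoid)"
proof (rule groupI)
  fix A :: "'a^3^3" assume "A \<in> carrier SL3"
  then have d: "det A = 1" by (simp add: special_linear_def)
  define B :: "'a^3^3" where
    "B = vector [vector [A$2$2*A$3$3 - A$2$3*A$3$2, A$1$3*A$3$2 - A$1$2*A$3$3, A$1$2*A$2$3 - A$1$3*A$2$2],
                 vector [A$2$3*A$3$1 - A$2$1*A$3$3, A$1$1*A$3$3 - A$1$3*A$3$1, A$1$3*A$2$1 - A$1$1*A$2$3],
                 vector [A$2$1*A$3$2 - A$2$2*A$3$1, A$1$2*A$3$1 - A$1$1*A$3$2, A$1$1*A$2$2 - A$1$2*A$2$1]]"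
  have BA: "B ** A = mat 1"
    using d unfolding B_def
    by (simp add: det_3 vec_eq_iff forall_3 matrix_matrix_mult_def sum_3 mat_def algebra_simps)
  have "det B * det A = 1" using arg_cong[OF BA, of det] by (simp add: det_mul)
  then have "det B = 1" using d by simp
  with BA show "\<exists>B\<in>carrier SL3. B \<otimes>\<^bsub>SL3\<^esub> A = \<one>\<^bsub>SL3\<^esub>"
    by (auto simp: special_linear_def)
qed (auto simp: special_linear_def det_mul matrix_mul_assoc)

end

theory Submission
  imports Defs
begin

text \<open>
  Entrywise reduction modulo \<open>p\<close> is a homomorphism \<open>SL\<^sub>3(\<int>) \<rightarrow> SL\<^sub>3(\<int>/p\<int>)\<close> whose kernel has no
  elements of order 3, also for \<open>p = 3\<close>. Hence it is a graph homomorphism between the triangle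
  graphs without the identity, and colorings pull back along it.

  For the kernel, let \<open>A = 1 + N\<close> with \<open>A\<^sup>3 = 1\<close>, so \<open>3N = -(3N\<^sup>2 + N\<^sup>3)\<close>. If \<open>p\<^sup>k\<close> divides \<open>N\<close>
  and \<open>k \<ge> 1\<close>, then comparing powers of \<open>p\<close> on both sides shows that \<open>p\<^sup>k\<^sup>+\<^sup>1\<close> divides \<open>N\<close>;
  therefore \<open>N = 0\<close>.
\<close>

lemma map_matrix_of_int_mult:
  fixes A :: "int ^ 'n::finite ^ 'm::finite" and B :: "int ^ 'l::finite ^ 'n"
  shows "(map_matrix of_int (A ** B) :: 'a::comm_ring_1 ^ 'l ^ 'm)
    = map_matrix of_int A ** map_matrix of_int B"
  by (simp add: vec_eq_iff matrix_matrix_mult_def)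

lemma map_matrix_of_int_one:
  "map_matrix of_int (mat 1) = (mat 1 :: 'a::comm_ring_1 ^ 'n::finite ^ 'n)"
  by (simp add: vec_eq_iff mat_def)

text \<open>The determinant is a polynomial in the entries with integer coefficients, so it commutes
  with ring homomorphisms.\<close>

lemma det_map_matrix_of_int:
  "det (map_matrix of_int A :: 'a::comm_ring_1 ^ 'n::finite ^ 'n) = of_int (det A)"
  by (simp add: det_def)

lemma group_hom_map_matrix_of_int:
  "group_hom SL3 SL3 (map_matrix of_int :: int ^ 3 ^ 3 \<Rightarrow> 'a::comm_ring_1 ^ 3 ^ 3)"
  by (intro group_hom.intro group_hom_axioms.intro group_SL3)
     (auto simp: hom_def special_linear_def det_map_matrix_of_int map_matrix_of_int_mult)

lemma matrix_add_rdistrib: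
  fixes A B :: "'a::semiring_1 ^ 'n::finite ^ 'm::finite" and C :: "'a ^ 'l::finite ^ 'n"
  shows "(A + B) ** C = A ** C + B ** C"
  by (simp add: vec_eq_iff matrix_matrix_mult_def distrib_right sum.distrib)

text \<open>Serves to pass from \<open>p ^ k\<close> dividing \<open>N\<close> to its square and
  cube dividing \<open>N ** N\<close> and \<open>N ** N ** N\<close>.\<close>

lemma dvd_matrix_mult:
  fixes A :: "int ^ 'n::finite ^ 'm::finite" and B :: "int ^ 'l::finite ^ 'n"
  assumes "\<And>i j. a dvd A $ i $ j" "\<And>i j. b dvd B $ i $ j"
  shows "a * b dvd (A ** B) $ i $ j"
  using assms by (simp add: matrix_matrix_mult_def dvd_sum mult_dvd_mono)

lemma cube_root_of_one_cong_one:
  fixes A :: "int ^ 'n::finite ^ 'n" and p :: int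
  assumes p: "prime p" and cube: "A ** A ** A = mat 1"
    and cong: "\<And>i j. p dvd (A - mat 1) $ i $ j"
  shows "A = mat 1"
proof -
  define N where "N = A - mat 1"
  have A: "A = mat 1 + N" by (simp add: N_def)
  \<comment> \<open>This is the expansion of (1 + N)^3 = 1, read entrywise. Multiples are first
    written as repeated sums, so that the laws of matrix sums and products suffice.\<close>
  have eq: "3 * N $ i $ j = - (3 * (N ** N) $ i $ j + (N ** N ** N) $ i $ j)" for i j
  proof -
    have "A ** A ** A = mat 1 + (N + N + N) + (N ** N + N ** N + N ** N) + N ** N ** N"
      by (simp only: A matrix_add_ldistrib matrix_add_rdistrib matrix_mul_lid matrix_mul_rid
          matrix_mul_assoc add_ac)
    then have "((N + N + N) + (N ** N + N ** N + N ** N) + N ** N ** N) $ i $ j = 0"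
      using cube by (simp add: add.assoc)
    then show ?thesis by simp
  qed
  have step: "p ^ Suc k dvd N $ i $ j" if "k \<ge> 1" and k: "\<And>i j. p ^ k dvd N $ i $ j" for k i j
  proof -
    have N2: "p ^ (k + k) dvd (N ** N) $ i $ j" for i j
      unfolding power_add using k by (intro dvd_matrix_mult)
    have N3: "p ^ (k + k + k) dvd (N ** N ** N) $ i $ j"
      unfolding power_add[of p "k + k"] using k N2 by (intro dvd_matrix_mult)
    show ?thesis
    proof (cases "p = 3")
      case True
      \<comment> \<open>Cancelling 3 = \<open>p\<close> on the left costs one power, so exponent k +
        2 is needed on the right. The factor 3 in front of \<open>N ** N\<close> supplies exponent
        2k + 1, and both 2k + 1 and 3k are at least k + 2 because k is at least 1.\<close>
      have "p ^ Suc (Suc k) dvd p ^ Suc (k + k)" "p ^ Suc (Suc k) dvd p ^ (k + k + k)"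
        by (intro le_imp_power_dvd; use \<open>k \<ge> 1\<close> in simp)+
      moreover have "p ^ Suc (k + k) dvd 3 * (N ** N) $ i $ j"
        using N2 True by simp
      ultimately have "p ^ Suc (Suc k) dvd 3 * N $ i $ j"
        unfolding eq dvd_minus_iff using dvd_trans N3 by (intro dvd_add) blast+
      then have "3 * p ^ Suc k dvd 3 * N $ i $ j" using True by simp
      then show ?thesis by (simp only: dvd_mult_cancel_left) simp
    next
      case False
      \<comment> \<open>Here 3 is coprime to \<open>p\<close> and cancels for free, so exponent k +
        1 suffices.\<close>
      have "p ^ Suc k dvd p ^ (k + k)" "p ^ Suc k dvd p ^ (k + k + k)"
        by (intro le_imp_power_dvd; use \<open>k \<ge> 1\<close> in simp)+
      then have "p ^ Suc k dvd 3 * N $ i $ j"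
        unfolding eq dvd_minus_iff using dvd_trans N2 N3 by (intro dvd_add dvd_mult) blast+
      moreover have "coprime (p ^ Suc k) 3"
        using False p by (simp add: primes_coprime)
      ultimately show ?thesis by (simp only: coprime_dvd_mult_right_iff)
    qed
  qed
  have pow: "p ^ Suc k dvd N $ i $ j" for k i j
  proof (induction k arbitrary: i j)
    case 0
    show ?case using cong by (simp add: N_def)
  next
    case (Suc k)
    show ?case by (rule step[OF _ Suc.IH]) simp
  qed
  \<comment> \<open>A nonzero integer is divisible by only finitely many powers of a
    non-unit.\<close>
  have "N $ i $ j = 0" for i j
  proof (rule ccontr)
    assume nz: "N $ i $ j \<noteq> 0"
    have "p ^ n dvd N $ i $ j" for n
      using pow[of n i j] dvd_trans[OF le_imp_power_dvd[of n "Suc n" p]] by simp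
    then have "{n. p ^ n dvd N $ i $ j} = UNIV" by auto
    with finite_divisor_powers[OF nz, of p] p show False
      by (auto simp: not_prime_unit)
  qed
  then show ?thesis by (simp add: A vec_eq_iff)
qed

text \<open>A coloring \<open>c\<close> of the target pulls back to \<open>c \<circ> f\<close>. The
  infimum is thus over a larger set for \<Gamma>, which also covers the value \<infinity>.\<close>

lemma chromatic_number_le_of_hom:
  assumes verts: "\<And>v. v \<in> verts \<Gamma> \<Longrightarrow> f v \<in> verts \<Delta>"
    and edges: "\<And>u v. {u, v} \<in> edges \<Gamma> \<Longrightarrow> {f u, f v} \<in> edges \<Delta>"
  shows "chromatic_number \<Gamma> \<le> chromatic_number \<Delta>"
proof -
  have "colorable \<Gamma> k" if k: "colorable \<Delta> k" for k
  proof -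
    obtain c :: "_ \<Rightarrow> nat" where "c ` verts \<Delta> \<subseteq> {..<k}" "\<forall>u v. {u, v} \<in> edges \<Delta> \<longrightarrow> c u \<noteq> c v"
      using k unfolding colorable_def by blast
    then have "(c \<circ> f) ` verts \<Gamma> \<subseteq> {..<k}" "\<forall>u v. {u, v} \<in> edges \<Gamma> \<longrightarrow> (c \<circ> f) u \<noteq> (c \<circ> f) v"
      using verts edges by (auto simp: image_subset_iff)
    then show ?thesis unfolding colorable_def by blast
  qed
  then show ?thesis
    unfolding chromatic_number_def by (intro Inf_superset_mono) auto
qed

text \<open>Homomorphisms preserve the defining relations of vertices and edges. That the kernel has
  no element of order 3 keeps the images of the remaining vertices away from the deleted
  identity.\<close>

lemma chromatic_number_triangle_graph_334_le:
  assumes "group_hom G H h"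
    and ker: "\<And>a. a \<in> carrier G \<Longrightarrow> a [^]\<^bsub>G\<^esub> (3::nat) = \<one>\<^bsub>G\<^esub> \<Longrightarrow> h a = \<one>\<^bsub>H\<^esub> \<Longrightarrow> a = \<one>\<^bsub>G\<^esub>"
  shows "chromatic_number (delete_vertex (triangle_graph_334 G) \<one>\<^bsub>G\<^esub>)
    \<le> chromatic_number (delete_vertex (triangle_graph_334 H) \<one>\<^bsub>H\<^esub>)"
proof -
  interpret group_hom G H h by fact
  have verts: "h a \<in> verts (triangle_graph_334 H)" if "a \<in> verts (triangle_graph_334 G)" for a
    using that by (auto simp: triangle_graph_334_def simp flip: hom_nat_pow)
  have ne: "h a \<noteq> \<one>\<^bsub>H\<^esub>" if "a \<in> verts (triangle_graph_334 G)" "a \<noteq> \<one>\<^bsub>G\<^esub>" for a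
    using that ker by (auto simp: triangle_graph_334_def)
  have carrier: "a \<in> carrier G" if "a \<in> verts (triangle_graph_334 G)" for a
    using that by (simp add: triangle_graph_334_def)
  have "{h a, h b} \<in> edges (triangle_graph_334 H)"
    if ab: "{a, b} \<in> edges (triangle_graph_334 G)" for a b
  proof -
    have "a \<in> verts (triangle_graph_334 G)" "b \<in> verts (triangle_graph_334 G)"
      and eq: "(a \<otimes>\<^bsub>G\<^esub> b) [^]\<^bsub>G\<^esub> (4::nat) = \<one>\<^bsub>G\<^esub>"
      using ab by (simp_all add: edge_triangle_graph_334_iff)
    moreover from this have "(h a \<otimes>\<^bsub>H\<^esub> h b) [^]\<^bsub>H\<^esub> (4::nat) = \<one>\<^bsub>H\<^esub>"
      using carrier hom_nat_pow[of "a \<otimes>\<^bsub>G\<^esub> b" 4] by simp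
    ultimately show ?thesis
      using verts by (simp add: edge_triangle_graph_334_iff)
  qed
  \<comment> \<open>Both ends of an edge are vertices, so \<open>ne\<close> shows that the image
    edge survives the deletion.\<close>
  moreover have "a \<in> verts (triangle_graph_334 G) \<and> b \<in> verts (triangle_graph_334 G)"
    if "{a, b} \<in> edges (triangle_graph_334 G)" for a b
    using that by (simp add: edge_triangle_graph_334_iff)
  ultimately show ?thesis
    using verts ne
    by (intro chromatic_number_le_of_hom[where f = h])
       (simp_all add: delete_vertex_def, metis (no_types, lifting))
qed

theorem theorem1:
  fixes p :: nat
  assumes "prime p" and "CARD('p::nontriv) = p"
  shows "chromatic_number
           (delete_vertex (triangle_graph_334 (SL3 :: (int ^ 3 ^ 3) monoid)) \<one>\<^bsub>SL3\<^esub>)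
       \<le> chromatic_number
           (delete_vertex (triangle_graph_334 (SL3 :: ('p mod_ring ^ 3 ^ 3) monoid)) \<one>\<^bsub>SL3\<^esub>)"
proof (rule chromatic_number_triangle_graph_334_le[OF group_hom_map_matrix_of_int])
  fix A :: "int ^ 3 ^ 3"
  assume cube: "A [^]\<^bsub>SL3\<^esub> (3::nat) = \<one>\<^bsub>SL3\<^esub>"
    and ker: "map_matrix of_int A = \<one>\<^bsub>(SL3 :: ('p mod_ring ^ 3 ^ 3) monoid)\<^esub>"
  have "prime (int p)" using assms(1) by simp
  moreover have "A ** A ** A = mat 1"
    using cube by (simp add: special_linear_def nat_pow_def numeral_3_eq_3)
  \<comment> \<open>Equality over \<open>'p mod_ring\<close> is congruence modulo its
    characteristic, which is \<open>CARD('p)\<close>.\<close>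
  moreover have "int p dvd (A - mat 1) $ i $ j" for i j
  proof -
    have "map_matrix of_int A $ i $ j = (map_matrix of_int (mat 1) $ i $ j :: 'p mod_ring)"
      using ker by (simp only: map_matrix_of_int_one) (simp add: special_linear_def)
    then have "(of_int ((A - mat 1) $ i $ j) :: 'p mod_ring) = 0" by simp
    then show ?thesis using assms(2) by (simp only: of_int_eq_0_iff_char_dvd semiring_char_mod_ring)
  qed
  ultimately have "A = mat 1" by (rule cube_root_of_one_cong_one)
  then show "A = \<one>\<^bsub>SL3\<^esub>" by (simp add: special_linear_def)
qed

end
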